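(* Let $G$ be the automorphism group of a countable saturated first-order structure with universe a countably infinite set $\Omega$, and let $X\subseteq\Omega$ be $G$-invariant. Then the localised pointwise convergence topology $\tau_{pw}^X$ on $\overline{G}$ is either equal to $\tau_{pw}$ or not $T_1$.
   Context: $\tau_{pw}$ is the topology of pointwise convergence on $\Omega^\Omega$ ($\Omega$ discrete) and $\overline{G}$ is the closure of $G$ in $\Omega^\Omega$. For $S\in\{G,\overline{G}\}$ and a partial map $\phi$ with finite domain, $S_\phi=\{s\in S: s\restriction \mathrm{dom}(\phi)=\phi\}$. For $G$-invariant $X\subseteq\Omega$, $\tau_{pw}^X$ on $S$ is the topology with subbasis the sets $S_\phi$ where $\phi:A\to B$ is the restriction of an element of $G$ to a finite set $A$, with $A,B\subseteq X$. *)

theory Defs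
  imports "HOL-Analysis.Analysis" "HOL-Library.Equipollence"
begin

section \<open>First-order logic\<close>

text \<open>The symbols of a language form sets rather than whole types, so that a language may have
  no function symbols or no relation symbols; there is no bound on the number of symbols.
  Constants are function symbols of arity 0.\<close>

record ('f, 'r) lang =
  fsyms :: "'f set"
  farity :: "'f \<Rightarrow> nat"
  rsyms :: "'r set"
  rarity :: "'r \<Rightarrow> nat"

text \<open>The universe of a structure is the whole type \<open>'a\<close>. Only the interpretations of symbols of the
  language at argument lists of the right length are ever used.\<close>

record ('f, 'r, 'a) struct =
  finterp :: "'f \<Rightarrow> 'a list \<Rightarrow> 'a"
  rinterp :: "'r \<Rightarrow> 'a list \<Rightarrow> bool"

datatype 'f trm = Var nat | Fn 'f "'f trm list"

datatype ('f, 'r) form =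
    Eq "'f trm" "'f trm"
  | Rel 'r "'f trm list"
  | Neg "('f, 'r) form"
  | Conj "('f, 'r) form" "('f, 'r) form"
  | Ex nat "('f, 'r) form"

primrec wf_trm :: "('f, 'r) lang \<Rightarrow> 'f trm \<Rightarrow> bool" where
  "wf_trm L (Var n) \<longleftrightarrow> True"
| "wf_trm L (Fn f ts) \<longleftrightarrow>
     f \<in> fsyms L \<and> length ts = farity L f \<and> (\<forall>b \<in> set (map (wf_trm L) ts). b)"

primrec wf_form :: "('f, 'r) lang \<Rightarrow> ('f, 'r) form \<Rightarrow> bool" where
  "wf_form L (Eq s t) \<longleftrightarrow> wf_trm L s \<and> wf_trm L t"
| "wf_form L (Rel r ts) \<longleftrightarrow>
     r \<in> rsyms L \<and> length ts = rarity L r \<and> (\<forall>t \<in> set ts. wf_trm L t)"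
| "wf_form L (Neg p) \<longleftrightarrow> wf_form L p"
| "wf_form L (Conj p q) \<longleftrightarrow> wf_form L p \<and> wf_form L q"
| "wf_form L (Ex n p) \<longleftrightarrow> wf_form L p"

primrec fv_trm :: "'f trm \<Rightarrow> nat set" where
  "fv_trm (Var n) = {n}"
| "fv_trm (Fn f ts) = \<Union> (set (map fv_trm ts))"

primrec fv :: "('f, 'r) form \<Rightarrow> nat set" where
  "fv (Eq s t) = fv_trm s \<union> fv_trm t"
| "fv (Rel r ts) = (\<Union>t \<in> set ts. fv_trm t)"
| "fv (Neg p) = fv p"
| "fv (Conj p q) = fv p \<union> fv q"
| "fv (Ex n p) = fv p - {n}"

primrec eval :: "('f, 'r, 'a) struct \<Rightarrow> (nat \<Rightarrow> 'a) \<Rightarrow> 'f trm \<Rightarrow> 'a" where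
  "eval M v (Var n) = v n"
| "eval M v (Fn f ts) = finterp M f (map (eval M v) ts)"

primrec sat :: "('f, 'r, 'a) struct \<Rightarrow> (nat \<Rightarrow> 'a) \<Rightarrow> ('f, 'r) form \<Rightarrow> bool" where
  "sat M v (Eq s t) \<longleftrightarrow> eval M v s = eval M v t"
| "sat M v (Rel r ts) \<longleftrightarrow> rinterp M r (map (eval M v) ts)"
| "sat M v (Neg p) \<longleftrightarrow> \<not> sat M v p"
| "sat M v (Conj p q) \<longleftrightarrow> sat M v p \<and> sat M v q"
| "sat M v (Ex n p) \<longleftrightarrow> (\<exists>a. sat M (v(n := a)) p)"


section \<open>Types and saturation\<close>

text \<open>The language \<open>L(A)\<close>, with a new constant \<open>Inr a\<close> for every parameter \<open>a \<in> A\<close>, and the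
  expansion of \<open>M\<close> in which \<open>Inr a\<close> names \<open>a\<close>.\<close>

definition lang_params :: "('f, 'r) lang \<Rightarrow> 'a set \<Rightarrow> ('f + 'a, 'r) lang" where
  "lang_params L A =
     \<lparr>fsyms = Inl ` fsyms L \<union> Inr ` A, farity = case_sum (farity L) (\<lambda>_. 0),
      rsyms = rsyms L, rarity = rarity L\<rparr>"

definition struct_params :: "('f, 'r, 'a) struct \<Rightarrow> ('f + 'a, 'r, 'a) struct" where
  "struct_params M =
     \<lparr>finterp = case_sum (finterp M) (\<lambda>a _. a), rinterp = rinterp M\<rparr>"

definition forms1 :: "('f, 'r) lang \<Rightarrow> 'a set \<Rightarrow> ('f + 'a, 'r) form set" where
  "forms1 L A = {p. wf_form (lang_params L A) p \<and> fv p \<subseteq> {0}}"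

text \<open>Only variable 0 may occur free in the formulas considered here, so the constant assignment
  \<open>\<lambda>_. a\<close> just assigns \<open>a\<close> to it.\<close>

definition realizes :: "('f, 'r, 'a) struct \<Rightarrow> 'a \<Rightarrow> ('f + 'a, 'r) form set \<Rightarrow> bool" where
  "realizes M a P \<longleftrightarrow> (\<forall>p \<in> P. sat (struct_params M) (\<lambda>_. a) p)"

definition finitely_satisfiable :: "('f, 'r, 'a) struct \<Rightarrow> ('f + 'a, 'r) form set \<Rightarrow> bool" where
  "finitely_satisfiable M P \<longleftrightarrow> (\<forall>F. finite F \<and> F \<subseteq> P \<longrightarrow> (\<exists>a. realizes M a F))"

definition complete_type ::
  "('f, 'r) lang \<Rightarrow> ('f, 'r, 'a) struct \<Rightarrow> 'a set \<Rightarrow> ('f + 'a, 'r) form set \<Rightarrow> bool" where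
  "complete_type L M A P \<longleftrightarrow>
     P \<subseteq> forms1 L A \<and> finitely_satisfiable M P \<and>
     (\<forall>Q. P \<subseteq> Q \<and> Q \<subseteq> forms1 L A \<and> finitely_satisfiable M Q \<longrightarrow> Q = P)"

definition saturated :: "('f, 'r) lang \<Rightarrow> ('f, 'r, 'a) struct \<Rightarrow> bool" where
  "saturated L M \<longleftrightarrow>
     (\<forall>A P. A \<prec> (UNIV :: 'a set) \<and> complete_type L M A P \<longrightarrow> (\<exists>a. realizes M a P))"


section \<open>Automorphisms and invariant sets\<close>

definition Aut :: "('f, 'r) lang \<Rightarrow> ('f, 'r, 'a) struct \<Rightarrow> ('a \<Rightarrow> 'a) set" where
  "Aut L M = {g. bij g \<and>
     (\<forall>f \<in> fsyms L. \<forall>xs. length xs = farity L f \<longrightarrow>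
        g (finterp M f xs) = finterp M f (map g xs)) \<and>
     (\<forall>r \<in> rsyms L. \<forall>xs. length xs = rarity L r \<longrightarrow>
        (rinterp M r (map g xs) \<longleftrightarrow> rinterp M r xs))}"

definition invariant_under :: "('a \<Rightarrow> 'a) set \<Rightarrow> 'a set \<Rightarrow> bool" where
  "invariant_under G X \<longleftrightarrow> (\<forall>g \<in> G. \<forall>x \<in> X. g x \<in> X)"


section \<open>Topologies on sets of self-maps\<close>

definition tau_pw :: "('a \<Rightarrow> 'a) topology" where
  "tau_pw = product_topology (\<lambda>_. discrete_topology UNIV) UNIV"

definition extending :: "('a \<Rightarrow> 'a) set \<Rightarrow> ('a \<rightharpoonup> 'a) \<Rightarrow> ('a \<Rightarrow> 'a) set" where
  "extending S \<phi> = {s \<in> S. (Some \<circ> s) |` dom \<phi> = \<phi>}"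

text \<open>\<open>topology_generated_by\<close> takes the union of the generating sets as the underlying space; the
  empty partial map contributes \<open>S\<close> itself as a generator.\<close>

definition tau_pw_local ::
  "('a \<Rightarrow> 'a) set \<Rightarrow> 'a set \<Rightarrow> ('a \<Rightarrow> 'a) set \<Rightarrow> ('a \<Rightarrow> 'a) topology" where
  "tau_pw_local G X S = topology_generated_by
     {extending S \<phi> | \<phi>. \<exists>g \<in> G. \<exists>A. finite A \<and> A \<subseteq> X \<and> g ` A \<subseteq> X \<and> \<phi> = (Some \<circ> g) |` A}"

lemma topspace_tau_pw_local:
  assumes "G \<noteq> {}"
  shows "topspace (tau_pw_local G X S) = S"
proof -
  obtain g where "g \<in> G" using assms by blast
  then have "\<exists>g \<in> G. \<exists>A. finite A \<and> A \<subseteq> X \<and> g ` A \<subseteq> X \<and> Map.empty = (Some \<circ> g) |` A"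
    by (intro bexI[of _ g] exI[of _ "{}"]) auto
  moreover have "extending S Map.empty = S"
    by (auto simp: extending_def)
  ultimately have "S \<in> {extending S \<phi> | \<phi>. \<exists>g \<in> G. \<exists>A. finite A \<and> A \<subseteq> X \<and> g ` A \<subseteq> X \<and> \<phi> = (Some \<circ> g) |` A}"
    by (intro CollectI exI[of _ Map.empty]) simp
  moreover have "extending S \<phi> \<subseteq> S" for \<phi>
    by (auto simp: extending_def)
  ultimately show ?thesis
    unfolding tau_pw_local_def topology_generated_by_topspace by blast
qed

end

theory Submission
  imports Defs
begin

text \<open>The topology \<open>\<tau>\<^sub>p\<^sub>w\<^sup>X\<close> is induced by restriction of maps to \<open>X\<close>, so if it is T1, an element of the
  closure of \<open>G\<close> is determined by its restriction to \<open>X\<close>. Suppose that nevertheless no finite subset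
  of \<open>X\<close> determines the value of \<open>s\<close> at some point \<open>b\<close>. Then the type which describes two elementary
  self-embeddings agreeing on \<open>X\<close> but not at \<open>b\<close> is finitely satisfiable, and since the universe is
  countable, saturation realises it one variable at a time. By homogeneity the two embeddings lie
  in the closure of \<open>G\<close>, a contradiction. Hence finite subsets of \<open>X\<close> determine each value, which
  says that the two topologies coincide.\<close>

section \<open>Semantics of formulas\<close>

lemma finite_fv_trm: "finite (fv_trm t)"
  by (induction t) auto

lemma finite_fv: "finite (fv p)"
  by (induction p) (auto simp: finite_fv_trm)

lemma eval_cong: "(\<And>i. i \<in> fv_trm t \<Longrightarrow> v i = w i) \<Longrightarrow> eval M v t = eval M w t"
proof (induction t)
  case (Fn f ts)
  then have "eval M v t = eval M w t" if "t \<in> set ts" for t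
    using that by (intro Fn.IH) auto
  then have "map (eval M v) ts = map (eval M w) ts" by simp
  then show ?case by (simp only: eval.simps)
qed simp

lemma sat_cong: "(\<And>i. i \<in> fv p \<Longrightarrow> v i = w i) \<Longrightarrow> sat M v p = sat M w p"
proof (induction p arbitrary: v w)
  case (Eq s t)
  then show ?case using eval_cong[of s v w M] eval_cong[of t v w M] by simp
next
  case (Rel r ts)
  then have "map (eval M v) ts = map (eval M w) ts"
    by (auto intro!: eval_cong)
  then show ?case by (simp only: sat.simps)
next
  case (Neg p)
  have "sat M v p = sat M w p" by (rule Neg.IH) (use Neg.prems in simp)
  then show ?case by simp
next
  case (Conj p q)
  have "sat M v p = sat M w p" "sat M v q = sat M w q"
    by (rule Conj.IH, use Conj.prems in simp)+
  then show ?case by simp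
next
  case (Ex n p)
  have "sat M (v(n := a)) p = sat M (w(n := a)) p" for a
    by (rule Ex.IH) (use Ex.prems in auto)
  then show ?case by simp
qed

section \<open>Finite conjunctions and existential projections\<close>

lemma ex_conjunction:
  fixes M :: "('f, 'r, 'a) struct"
  assumes "finite F" "\<forall>p \<in> F. wf_form L p"
  shows "\<exists>q. wf_form L q \<and> (\<forall>v. sat M v q \<longleftrightarrow> (\<forall>p \<in> F. sat M v p))"
  using assms
proof (induction F)
  case empty
  \<comment> \<open>The syntax has no constant for truth, so a closed valid formula serves as the
    empty conjunction.\<close>
  have "wf_form L (Ex 0 (Eq (Var 0) (Var 0)))" by simp
  then show ?case by (intro exI[of _ "Ex 0 (Eq (Var 0) (Var 0))"]) simp
next
  case (insert p F)
  then obtain q where "wf_form L q" "\<forall>v. sat M v q \<longleftrightarrow> (\<forall>p \<in> F. sat M v p)"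
    by auto
  with insert.prems show ?case by (intro exI[of _ "Conj p q"]) auto
qed

lemma ex_projection:
  fixes M :: "('f, 'r, 'a) struct"
  assumes "finite K" "wf_form L q"
  shows "\<exists>q'. wf_form L q' \<and> fv q' = fv q - K \<and>
           (\<forall>v. sat M v q' \<longleftrightarrow> (\<exists>w. (\<forall>i. i \<notin> K \<longrightarrow> w i = v i) \<and> sat M w q))"
  using assms(1)
proof (induction K)
  case empty
  have "(\<forall>i. w i = v i) \<longleftrightarrow> w = v" for v w :: "nat \<Rightarrow> 'a" by auto
  with assms(2) show ?case by (intro exI[of _ q]) auto
next
  case (insert k K)
  then obtain q' where q': "wf_form L q'" "fv q' = fv q - K"
    "\<And>v. sat M v q' \<longleftrightarrow> (\<exists>w. (\<forall>i. i \<notin> K \<longrightarrow> w i = v i) \<and> sat M w q)"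
    by auto
  have "sat M v (Ex k q') \<longleftrightarrow> (\<exists>w. (\<forall>i. i \<notin> insert k K \<longrightarrow> w i = v i) \<and> sat M w q)"
    (is "_ = ?R") for v
  proof
    assume "sat M v (Ex k q')"
    then obtain a w where "\<forall>i. i \<notin> K \<longrightarrow> w i = (v(k := a)) i" "sat M w q"
      using q'(3) by auto
    then show ?R by (intro exI[of _ w]) auto
  next
    assume ?R
    then obtain w where w: "\<forall>i. i \<notin> insert k K \<longrightarrow> w i = v i" "sat M w q" by blast
    then have "sat M (v(k := w k)) q'"
      unfolding q'(3) by (intro exI[of _ w]) auto
    then show "sat M v (Ex k q')" by auto
  qed
  then show ?case using q'(1,2) by (intro exI[of _ "Ex k q'"]) auto
qed

text \<open>That values on \<open>S\<close> extend to a solution of finitely many formulas thus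
  becomes a single formula, which saturation and elementary equivalence can handle. Both
  \<open>S\<close> and its complement may be infinite: only finitely many variables get
  quantified.\<close>

lemma ex_projected_conjunction:
  fixes M :: "('f, 'r, 'a) struct"
  assumes "finite F" "\<forall>p \<in> F. wf_form L p"
  obtains q where "wf_form L q" "fv q \<subseteq> S"
    "\<And>v. sat M v q \<longleftrightarrow> (\<exists>w. (\<forall>i \<in> S. w i = v i) \<and> (\<forall>p \<in> F. sat M w p))"
proof -
  obtain q0 where q0: "wf_form L q0" "\<And>v. sat M v q0 \<longleftrightarrow> (\<forall>p \<in> F. sat M v p)"
    using ex_conjunction[OF assms] by blast
  have "finite (fv q0 - S)" by (simp add: finite_fv)
  then obtain q where q: "wf_form L q" "fv q = fv q0 - (fv q0 - S)"
    "\<And>v. sat M v q \<longleftrightarrow> (\<exists>w. (\<forall>i. i \<notin> fv q0 - S \<longrightarrow> w i = v i) \<and> sat M w q0)"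
    using ex_projection[of "fv q0 - S" L q0 M] q0(1) by blast
  have "sat M v q \<longleftrightarrow> (\<exists>w. (\<forall>i \<in> S. w i = v i) \<and> sat M w q0)" (is "_ = ?R") for v
  proof
    assume "sat M v q"
    then show ?R unfolding q(3) by blast
  next
    assume ?R
    then obtain w where w: "\<forall>i \<in> S. w i = v i" "sat M w q0" by blast
    \<comment> \<open>\<open>w\<close> may differ from \<open>v\<close> at variables that
      \<open>q0\<close> does not mention; resetting these to \<open>v\<close> leaves the truth of
      \<open>q0\<close> unchanged.\<close>
    let ?w = "\<lambda>i. if i \<in> fv q0 - S then w i else v i"
    have "sat M ?w q0 = sat M w q0"
      by (rule sat_cong) (use w(1) in auto)
    then show "sat M v q"
      unfolding q(3) using w(2) by (intro exI[of _ ?w]) auto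
  qed
  then show thesis using that[of q] q q0(2) by auto
qed

section \<open>Substituting parameters for variables\<close>

primrec subst_trm :: "(nat \<rightharpoonup> 'a) \<Rightarrow> 'f trm \<Rightarrow> ('f + 'a) trm" where
  "subst_trm \<sigma> (Var n) = (case \<sigma> n of None \<Rightarrow> Var n | Some a \<Rightarrow> Fn (Inr a) [])"
| "subst_trm \<sigma> (Fn f ts) = Fn (Inl f) (map (subst_trm \<sigma>) ts)"

text \<open>The substituted terms are constants, so nothing can be captured; a quantifier only has
  to shield its own variable from \<open>\<sigma>\<close>.\<close>

primrec subst_form :: "(nat \<rightharpoonup> 'a) \<Rightarrow> ('f, 'r) form \<Rightarrow> ('f + 'a, 'r) form" where
  "subst_form \<sigma> (Eq s t) = Eq (subst_trm \<sigma> s) (subst_trm \<sigma> t)"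
| "subst_form \<sigma> (Rel r ts) = Rel r (map (subst_trm \<sigma>) ts)"
| "subst_form \<sigma> (Neg p) = Neg (subst_form \<sigma> p)"
| "subst_form \<sigma> (Conj p q) = Conj (subst_form \<sigma> p) (subst_form \<sigma> q)"
| "subst_form \<sigma> (Ex n p) = Ex n (subst_form (\<sigma>(n := None)) p)"

lemma eval_subst_trm:
  "eval (struct_params M) v (subst_trm \<sigma> t) =
     eval M (\<lambda>n. case \<sigma> n of None \<Rightarrow> v n | Some a \<Rightarrow> a) t"
proof (induction t)
  case (Fn f ts)
  then have "map (eval (struct_params M) v \<circ> subst_trm \<sigma>) ts =
      map (eval M (\<lambda>n. case \<sigma> n of None \<Rightarrow> v n | Some a \<Rightarrow> a)) ts"
    by simp
  then show ?case by (simp add: struct_params_def del: map_eq_conv)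
qed (simp add: struct_params_def split: option.split)

lemma sat_subst_form:
  "sat (struct_params M) v (subst_form \<sigma> p) \<longleftrightarrow>
     sat M (\<lambda>n. case \<sigma> n of None \<Rightarrow> v n | Some a \<Rightarrow> a) p"
proof (induction p arbitrary: v \<sigma>)
  case (Rel r ts)
  have "map (eval (struct_params M) v \<circ> subst_trm \<sigma>) ts =
      map (eval M (\<lambda>n. case \<sigma> n of None \<Rightarrow> v n | Some a \<Rightarrow> a)) ts"
    by (simp add: eval_subst_trm)
  then show ?case by (simp add: struct_params_def del: map_eq_conv)
next
  case (Ex n p)
  have "(\<lambda>k. case (\<sigma>(n := None)) k of None \<Rightarrow> (v(n := a)) k | Some b \<Rightarrow> b) =
      (\<lambda>k. case \<sigma> k of None \<Rightarrow> v k | Some b \<Rightarrow> b)(n := a)" for a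
    by (auto split: option.split)
  with Ex show ?case by simp
qed (auto simp: eval_subst_trm)

lemma fv_subst_trm: "fv_trm (subst_trm \<sigma> t) = fv_trm t - dom \<sigma>"
  by (induction t) (auto split: option.split)

lemma fv_subst_form: "fv (subst_form \<sigma> p) = fv p - dom \<sigma>"
  by (induction p arbitrary: \<sigma>) (auto simp: fv_subst_trm)

lemma wf_subst_trm:
  "ran \<sigma> \<subseteq> A \<Longrightarrow> wf_trm L t \<Longrightarrow> wf_trm (lang_params L A) (subst_trm \<sigma> t)"
proof (induction t)
  case (Var n)
  then show ?case by (auto simp: lang_params_def intro: ranI split: option.split)
next
  case (Fn f ts)
  then show ?case by (auto simp: lang_params_def)
qed

lemma wf_subst_form:
  "ran \<sigma> \<subseteq> A \<Longrightarrow> wf_form L p \<Longrightarrow> wf_form (lang_params L A) (subst_form \<sigma> p)"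
proof (induction p arbitrary: \<sigma>)
  case (Rel r ts)
  have "wf_trm (lang_params L A) (subst_trm \<sigma> t)" if "t \<in> set ts" for t
    by (rule wf_subst_trm) (use Rel that in auto)
  with Rel show ?case by (auto simp: lang_params_def)
next
  case (Ex n p)
  have "ran (\<sigma>(n := None)) \<subseteq> A" using Ex.prems(1) by (auto simp: ran_def split: if_splits)
  with Ex show ?case by simp
qed (auto intro: wf_subst_trm)


section \<open>Realising types in a saturated structure\<close>

text \<open>Zorn's lemma applies because a finite subset of the union of a nonempty chain lies in
  one member. The extension is needed since \<open>saturated\<close> speaks of maximal types
  only.\<close>

lemma finitely_satisfiable_extends:
  assumes "Q \<subseteq> forms1 L A" "finitely_satisfiable M Q"
  shows "\<exists>P. complete_type L M A P \<and> Q \<subseteq> P"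
proof -
  let ?C = "{P. Q \<subseteq> P \<and> P \<subseteq> forms1 L A \<and> finitely_satisfiable M P}"
  have "\<exists>P \<in> ?C. \<forall>R \<in> ?C. P \<subseteq> R \<longrightarrow> R = P"
  proof (rule subset_Zorn_nonempty)
    show "?C \<noteq> {}" using assms by blast
    fix \<C> assume ne: "\<C> \<noteq> {}" and ch: "subset.chain ?C \<C>"
    have "finitely_satisfiable M (\<Union>\<C>)"
      unfolding finitely_satisfiable_def
    proof (intro allI impI)
      fix F assume "finite F \<and> F \<subseteq> \<Union>\<C>"
      then obtain P where "P \<in> \<C>" "F \<subseteq> P"
        using finite_subset_Union_chain[of F \<C> ?C] ne ch by blast
      with ch \<open>finite F \<and> F \<subseteq> \<Union>\<C>\<close> show "\<exists>a. realizes M a F"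
        by (auto simp: subset.chain_def finitely_satisfiable_def)
    qed
    moreover have "\<C> \<subseteq> ?C" using ch by (simp add: subset.chain_def)
    then have "Q \<subseteq> \<Union>\<C>" "\<Union>\<C> \<subseteq> forms1 L A"
      using ne by blast+
    ultimately show "\<Union>\<C> \<in> ?C" by simp
  qed
  then obtain P where P: "P \<in> ?C" and max: "\<forall>R \<in> ?C. P \<subseteq> R \<longrightarrow> R = P" by (rule bexE)
  have "R = P" if "P \<subseteq> R" "R \<subseteq> forms1 L A" "finitely_satisfiable M R" for R
    by (rule max[rule_format]) (use P that in auto)
  with P have "complete_type L M A P \<and> Q \<subseteq> P" by (simp add: complete_type_def)
  then show ?thesis ..
qed

text \<open>The free variable \<open>n\<close> is moved to variable 0 by \<open>\<exists>n. n = 0 \<and> p\<close>, which avoids a capturing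
  renaming of \<open>p\<close>.\<close>

lemma saturated_realizes_one:
  fixes M :: "('f, 'r, 'a) struct"
  assumes "infinite (UNIV :: 'a set)" "saturated L M" "finite D" "n \<notin> D"
    and P: "\<And>p. p \<in> P \<Longrightarrow> wf_form L p \<and> fv p \<subseteq> insert n D"
    and fs: "\<And>F. finite F \<Longrightarrow> F \<subseteq> P \<Longrightarrow> \<exists>a. \<forall>p \<in> F. sat M (v(n := a)) p"
  shows "\<exists>a. \<forall>p \<in> P. sat M (v(n := a)) p"
proof -
  \<comment> \<open>Variables in \<open>D\<close> become constants for their values under
    \<open>v\<close>, which leaves at most \<open>n\<close> free; the finitely many parameters are
    fewer than the elements of the universe.\<close>
  define \<sigma> where "\<sigma> = (Some \<circ> v) |` D"
  define T where "T p = (if n = 0 then subst_form \<sigma> p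
      else Ex n (Conj (Eq (Var n) (Var 0)) (subst_form \<sigma> p)))" for p :: "('f, 'r) form"
  have ran: "ran \<sigma> \<subseteq> v ` D" by (auto simp: \<sigma>_def ran_def restrict_map_def)
  have dom: "dom \<sigma> = D" by (auto simp: \<sigma>_def)
  have fvs: "fv (subst_form \<sigma> p) \<subseteq> {n}" if "p \<in> P" for p
    using P[OF that] dom by (auto simp: fv_subst_form)
  have T_forms: "T p \<in> forms1 L (v ` D)" if "p \<in> P" for p
    using fvs[OF that] wf_subst_form[OF ran] P[OF that] by (auto simp: T_def forms1_def)
  have T_sat: "sat (struct_params M) (\<lambda>_. a) (T p) \<longleftrightarrow> sat M (v(n := a)) p" if "p \<in> P" for a p
  proof -
    have "sat (struct_params M) (\<lambda>_. a) (T p) \<longleftrightarrow> sat (struct_params M) ((\<lambda>_. a)(n := a)) (subst_form \<sigma> p)"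
      by (auto simp: T_def fun_upd_idem)
    \<comment> \<open>The constant assignment also gives \<open>a\<close> to variables outside
      \<open>D\<close>, but apart from \<open>n\<close> none of these is free in
      \<open>p\<close>.\<close>
    also have "\<dots> \<longleftrightarrow> sat M (v(n := a)) p"
      unfolding sat_subst_form using P[OF that] assms(4)
      by (intro sat_cong) (auto simp: \<sigma>_def restrict_map_def)
    finally show ?thesis .
  qed
  have "finitely_satisfiable M (T ` P)"
    unfolding finitely_satisfiable_def
  proof (intro allI impI)
    fix F assume "finite F \<and> F \<subseteq> T ` P"
    then obtain F' where F': "F' \<subseteq> P" "finite F'" "F = T ` F'"
      by (meson finite_subset_image)
    obtain a where "\<forall>p \<in> F'. sat M (v(n := a)) p" using fs F' by blast
    then have "realizes M a F"
      using F' T_sat by (auto simp: realizes_def)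
    then show "\<exists>a. realizes M a F" ..
  qed
  moreover have "T ` P \<subseteq> forms1 L (v ` D)" using T_forms by blast
  ultimately obtain R where R: "complete_type L M (v ` D) R" "T ` P \<subseteq> R"
    using finitely_satisfiable_extends by blast
  have "v ` D \<prec> (UNIV :: 'a set)"
    using assms(1,3) by (simp add: finite_lesspoll_infinite)
  with R(1) assms(2) obtain a where "realizes M a R" unfolding saturated_def by blast
  with R(2) T_sat have "\<forall>p \<in> P. sat M (v(n := a)) p" unfolding realizes_def by blast
  then show ?thesis ..
qed

text \<open>Dependent choice of one value after another. Earlier values are never revised, so the
  stages have a pointwise limit, and \<open>local\<close> carries each \<open>P n\<close> over to
  it. Realising types takes \<open>N = 0\<close>; back and forth keeps a given tuple in the first
  \<open>N\<close> places.\<close>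

lemma ex_limit_sequence:
  fixes v0 :: "nat \<Rightarrow> 'b"
  assumes start: "P N v0"
    and step: "\<And>n v. N \<le> n \<Longrightarrow> P n v \<Longrightarrow> \<exists>a. P (Suc n) (v(n := a))"
    and local: "\<And>n v w. N \<le> n \<Longrightarrow> P n v \<Longrightarrow> \<forall>i<n. v i = w i \<Longrightarrow> P n w"
  shows "\<exists>v. (\<forall>i<N. v i = v0 i) \<and> (\<forall>n\<ge>N. P n v)"
proof -
  have "\<exists>f. \<forall>n. (P (N + n) (f n) \<and> (\<forall>i<N. f n i = v0 i)) \<and> (\<forall>i<N + n. f (Suc n) i = f n i)"
  proof (rule dependent_nat_choice)
    show "\<exists>x. P (N + 0) x \<and> (\<forall>i<N. x i = v0 i)" using start by auto
    fix x n assume x: "P (N + n) x \<and> (\<forall>i<N. x i = v0 i)"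
    then obtain a where "P (Suc (N + n)) (x(N + n := a))"
      using step[of "N + n" x] by auto
    with x show "\<exists>y. (P (N + Suc n) y \<and> (\<forall>i<N. y i = v0 i)) \<and> (\<forall>i<N + n. y i = x i)"
      by (intro exI[of _ "x(N + n := a)"]) auto
  qed
  then obtain f where f: "\<And>n. P (N + n) (f n)" "\<And>n i. i < N \<Longrightarrow> f n i = v0 i"
    "\<And>n i. i < N + n \<Longrightarrow> f (Suc n) i = f n i"
    by metis
  have stable: "f (n + k) i = f n i" if "i < N + n" for n k i
    using that by (induction k) (auto simp: f(3))
  \<comment> \<open>Value \<open>i\<close> is settled from stage \<open>Suc i\<close> on, whatever
    \<open>N\<close> is, so the diagonal \<open>f (Suc i) i\<close> is the limit.\<close>
  have lim: "f (Suc i) i = f n i" if "i < N + n" for i n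
    using stable[of i n "Suc i"] stable[of i "Suc i" n] that by (simp add: add.commute)
  show ?thesis
  proof (intro exI[of _ "\<lambda>i. f (Suc i) i"] conjI allI impI)
    fix n assume "N \<le> n"
    then obtain m where n: "n = N + m" using le_Suc_ex by blast
    show "P n (\<lambda>i. f (Suc i) i)"
      by (rule local[of n "f m"]) (use f(1) lim n in auto)
  qed (use f(2) in auto)
qed

text \<open>Variables get their values one by one, each realising a type over the finitely many
  earlier values. The limit satisfies \<open>\<Sigma>\<close> because each formula has only finitely
  many free variables.\<close>

lemma saturated_realizes_all:
  fixes M :: "('f, 'r, 'a) struct"
  assumes "infinite (UNIV :: 'a set)" "saturated L M"
    and wf: "\<And>p. p \<in> \<Sigma> \<Longrightarrow> wf_form L p"
    and fs: "\<And>F. finite F \<Longrightarrow> F \<subseteq> \<Sigma> \<Longrightarrow> \<exists>v. \<forall>p \<in> F. sat M v p"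
  shows "\<exists>v. \<forall>p \<in> \<Sigma>. sat M v p"
proof -
  \<comment> \<open>The invariant: the first \<open>n\<close> values of \<open>v\<close> extend to a
    solution of every finite part of \<open>\<Sigma>\<close>. The extension may depend on the
    part.\<close>
  define ok where "ok n v \<longleftrightarrow> (\<forall>F. finite F \<and> F \<subseteq> \<Sigma> \<longrightarrow>
      (\<exists>w. (\<forall>i<n. w i = v i) \<and> (\<forall>p \<in> F. sat M w p)))" for n and v :: "nat \<Rightarrow> 'a"
  have step: "\<exists>a. ok (Suc n) (v(n := a))" if "ok n v" for n v
  proof -
    \<comment> \<open>These are the projections of all finite parts of \<open>\<Sigma>\<close> onto
      the variables up to \<open>n\<close>; a value at \<open>n\<close> satisfies them all exactly
      if it keeps the invariant.\<close>
    define P where "P = {q. wf_form L q \<and> fv q \<subseteq> {..n} \<and> (\<exists>F. finite F \<and> F \<subseteq> \<Sigma> \<and>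
        (\<forall>u. sat M u q \<longleftrightarrow> (\<exists>w. (\<forall>i \<in> {..n}. w i = u i) \<and> (\<forall>p \<in> F. sat M w p))))}"
    have "\<exists>a. \<forall>p \<in> P. sat M (v(n := a)) p"
    proof (rule saturated_realizes_one[OF assms(1,2), of "{..<n}"])
      fix F assume F: "finite F" "F \<subseteq> P"
      have "\<forall>q \<in> F. \<exists>H. finite H \<and> H \<subseteq> \<Sigma> \<and>
        (\<forall>u. sat M u q \<longleftrightarrow> (\<exists>w. (\<forall>i \<in> {..n}. w i = u i) \<and> (\<forall>p \<in> H. sat M w p)))"
        using F(2) unfolding P_def by blast
      then obtain H where H: "\<And>q. q \<in> F \<Longrightarrow> finite (H q) \<and> H q \<subseteq> \<Sigma>"
        "\<And>q u. q \<in> F \<Longrightarrow> sat M u q \<longleftrightarrow>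
           (\<exists>w. (\<forall>i \<in> {..n}. w i = u i) \<and> (\<forall>p \<in> H q. sat M w p))"
        by metis
      \<comment> \<open>The finite parts behind the members of \<open>F\<close> are merged, so that
        one solution \<open>w\<close> supplies a value at \<open>n\<close> serving them all.\<close>
      have "finite (\<Union>(H ` F)) \<and> \<Union>(H ` F) \<subseteq> \<Sigma>" using F(1) H(1) by blast
      then obtain w where w: "\<forall>i<n. w i = v i" "\<forall>p \<in> \<Union>(H ` F). sat M w p"
        using \<open>ok n v\<close>[unfolded ok_def, rule_format, of "\<Union>(H ` F)"] by blast
      have "sat M (v(n := w n)) q" if "q \<in> F" for q
        unfolding H(2)[OF that] using w that
        by (intro exI[of _ w]) (auto simp: le_less)
      then show "\<exists>a. \<forall>p \<in> F. sat M (v(n := a)) p" by blast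
    qed (auto simp: P_def)
    then obtain a where a: "\<forall>p \<in> P. sat M (v(n := a)) p" ..
    have "ok (Suc n) (v(n := a))"
      unfolding ok_def
    proof (intro allI impI)
      fix F assume F: "finite F \<and> F \<subseteq> \<Sigma>"
      then obtain q where q: "wf_form L q" "fv q \<subseteq> {..n}"
        "\<And>u. sat M u q \<longleftrightarrow> (\<exists>w. (\<forall>i \<in> {..n}. w i = u i) \<and> (\<forall>p \<in> F. sat M w p))"
        using ex_projected_conjunction[of F L "{..n}" M] wf by blast
      then have "q \<in> P" using F unfolding P_def by blast
      with a q(3) show "\<exists>w. (\<forall>i<Suc n. w i = (v(n := a)) i) \<and> (\<forall>p \<in> F. sat M w p)"
        by (metis atMost_iff less_Suc_eq_le)
    qed
    then show ?thesis ..
  qed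
  have start: "ok 0 (\<lambda>_. undefined)" using fs by (auto simp: ok_def)
  have local: "ok n w" if "ok n v" "\<forall>i<n. v i = w i" for n v w
    using that by (simp add: ok_def)
  have "\<exists>v. (\<forall>i<0. v i = undefined) \<and> (\<forall>n\<ge>0. ok n v)"
    by (rule ex_limit_sequence[where P = ok, OF start]) (use step local in blast)+
  then obtain v where v: "\<And>n. ok n v" by auto
  have "sat M v p" if "p \<in> \<Sigma>" for p
  proof -
    obtain n where n: "\<forall>i \<in> fv p. i < n" using finite_fv finite_nat_set_iff_bounded by blast
    obtain w where "\<forall>i<n. w i = v i" "sat M w p"
      using v[of n, unfolded ok_def, rule_format, of "{p}"] \<open>p \<in> \<Sigma>\<close> by auto
    then show ?thesis using sat_cong[of p v w M] n by auto
  qed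
  then show ?thesis by blast
qed


section \<open>Homogeneity\<close>

definition elem_equiv ::
  "('f, 'r) lang \<Rightarrow> ('f, 'r, 'a) struct \<Rightarrow> nat set \<Rightarrow> (nat \<Rightarrow> 'a) \<Rightarrow> (nat \<Rightarrow> 'a) \<Rightarrow> bool" where
  "elem_equiv L M D v w \<longleftrightarrow>
     (\<forall>p. wf_form L p \<and> fv p \<subseteq> D \<longrightarrow> (sat M v p \<longleftrightarrow> sat M w p))"

lemma elem_equiv_sym: "elem_equiv L M D v w \<Longrightarrow> elem_equiv L M D w v"
  by (auto simp: elem_equiv_def)

lemma elem_equiv_cong:
  assumes "elem_equiv L M D v w" "\<And>i. i \<in> D \<Longrightarrow> v i = v' i" "\<And>i. i \<in> D \<Longrightarrow> w i = w' i"
  shows "elem_equiv L M D v' w'"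
  unfolding elem_equiv_def
proof (intro allI impI)
  fix p assume p: "wf_form L p \<and> fv p \<subseteq> D"
  then have "sat M v p = sat M v' p" "sat M w p = sat M w' p"
    using assms(2,3) by (auto intro!: sat_cong)
  with p assms(1) show "sat M v' p = sat M w' p" by (auto simp: elem_equiv_def)
qed

text \<open>One step of back and forth: \<open>b\<close> realises over \<open>w\<close> the type of
  \<open>a\<close> over \<open>v\<close>. Finite parts of this type are satisfiable because their
  projections onto \<open>D\<close> hold at \<open>v\<close>, hence at \<open>w\<close>.\<close>

lemma elem_equiv_extend:
  fixes M :: "('f, 'r, 'a) struct"
  assumes "infinite (UNIV :: 'a set)" "saturated L M" "finite D" "n \<notin> D"
    and eq: "elem_equiv L M D v w"
  shows "\<exists>b. elem_equiv L M (insert n D) (v(n := a)) (w(n := b))"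
proof -
  define P where "P = {p. wf_form L p \<and> fv p \<subseteq> insert n D \<and> sat M (v(n := a)) p}"
  have "\<exists>b. \<forall>p \<in> P. sat M (w(n := b)) p"
  proof (rule saturated_realizes_one[OF assms(1-4)])
    fix F assume F: "finite F" "F \<subseteq> P"
    then obtain q where q: "wf_form L q" "fv q \<subseteq> D"
      "\<And>u. sat M u q \<longleftrightarrow> (\<exists>w. (\<forall>i \<in> D. w i = u i) \<and> (\<forall>p \<in> F. sat M w p))"
      using ex_projected_conjunction[of F L D M] unfolding P_def by blast
    have "sat M v q" unfolding q(3)
      by (intro exI[of _ "v(n := a)"]) (use F assms(4) in \<open>auto simp: P_def\<close>)
    with eq q obtain u where u: "\<forall>i \<in> D. u i = w i" "\<forall>p \<in> F. sat M u p"
      unfolding elem_equiv_def by blast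
    have "sat M (w(n := u n)) p" if "p \<in> F" for p
    proof -
      have "sat M (w(n := u n)) p = sat M u p"
        by (rule sat_cong) (use u(1) F(2) that in \<open>fastforce simp: P_def\<close>)
      with u that show ?thesis by simp
    qed
    then show "\<exists>b. \<forall>p \<in> F. sat M (w(n := b)) p" by blast
  qed (auto simp: P_def)
  then obtain b where b: "\<forall>p \<in> P. sat M (w(n := b)) p" ..
  have "sat M (v(n := a)) p \<longleftrightarrow> sat M (w(n := b)) p"
    if "wf_form L p" "fv p \<subseteq> insert n D" for p
  proof (cases "sat M (v(n := a)) p")
    case True
    with b that show ?thesis by (auto simp: P_def)
  next
    case False
    \<comment> \<open>\<open>P\<close> contains each formula or its negation, so satisfying
      \<open>P\<close> yields both directions.\<close>
    with that have "Neg p \<in> P" by (simp add: P_def)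
    with b False show ?thesis by auto
  qed
  then show ?thesis by (auto simp: elem_equiv_def)
qed

text \<open>Sending \<open>v i\<close> to \<open>w i\<close> is well defined and injective because
  equations between variables transfer, and total and onto because both tuples exhaust the universe.
  Other atomic formulas transfer the operations and relations.\<close>

lemma Aut_of_elem_equiv:
  fixes M :: "('f, 'r, 'a) struct"
  assumes eq: "elem_equiv L M E v w" and v: "v ` E = UNIV" and w: "w ` E = UNIV"
  shows "\<exists>g \<in> Aut L M. \<forall>i \<in> E. g (v i) = w i"
proof -
  have v_eq_iff: "v i = v j \<longleftrightarrow> w i = w j" if "i \<in> E" "j \<in> E" for i j
    using eq[unfolded elem_equiv_def, rule_format, of "Eq (Var i) (Var j)"] that by auto
  \<comment> \<open>\<open>h\<close> picks an index for each element, so that a list of elements can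
    be written as a list of variables from \<open>E\<close>.\<close>
  define h where "h = inv_into E v"
  define g where "g = w \<circ> h"
  have h: "h a \<in> E" "v (h a) = a" for a
    unfolding h_def using v by (simp_all add: inv_into_into f_inv_into_f)
  have g: "g (v i) = w i" if "i \<in> E" for i
    using v_eq_iff[of "h (v i)" i] h that by (simp add: g_def)
  have "inj g"
  proof (rule injI)
    fix a b assume "g a = g b"
    then show "a = b" using v_eq_iff[OF h(1) h(1), of a b] h(2) by (simp add: g_def)
  qed
  moreover have "surj g"
  proof (rule surjI)
    fix b show "g (v (inv_into E w b)) = b"
      using w by (simp add: g inv_into_into f_inv_into_f)
  qed
  moreover have "g (finterp M f xs) = finterp M f (map g xs)"
    if "f \<in> fsyms L" "length xs = farity L f" for f xs
  proof -
    let ?p = "Eq (Fn f (map (Var \<circ> h) xs)) (Var (h (finterp M f xs)))"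
    have "wf_form L ?p" "fv ?p \<subseteq> E" using that h(1) by auto
    then have "sat M v ?p = sat M w ?p" using eq unfolding elem_equiv_def by blast
    moreover have "map (eval M v \<circ> (Var \<circ> h)) xs = xs" by (simp add: h(2) comp_def)
    moreover have "map (eval M w \<circ> (Var \<circ> h)) xs = map g xs" by (simp add: g_def)
    ultimately show ?thesis using h(2) by (simp add: g_def)
  qed
  moreover have "rinterp M r (map g xs) \<longleftrightarrow> rinterp M r xs"
    if "r \<in> rsyms L" "length xs = rarity L r" for r xs
  proof -
    let ?p = "Rel r (map (Var \<circ> h) xs)"
    have "wf_form L ?p" "fv ?p \<subseteq> E" using that h(1) by auto
    then have "sat M v ?p = sat M w ?p" using eq unfolding elem_equiv_def by blast
    moreover have "map (eval M v \<circ> (Var \<circ> h)) xs = xs" by (simp add: h(2) comp_def)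
    moreover have "map (eval M w \<circ> (Var \<circ> h)) xs = map g xs" by (simp add: g_def)
    ultimately show ?thesis by simp
  qed
  ultimately have "g \<in> Aut L M" by (simp add: Aut_def bij_def)
  with g show ?thesis by blast
qed

text \<open>Back and forth: the variables from \<open>N\<close> on alternately enumerate the universe on the
  left and on the right.\<close>

lemma saturated_homogeneous:
  fixes M :: "('f, 'r, 'a) struct"
  assumes count: "countable (UNIV :: 'a set)" and inf: "infinite (UNIV :: 'a set)"
    and sat: "saturated L M" and "finite D" and eq: "elem_equiv L M D v w"
  shows "\<exists>g \<in> Aut L M. \<forall>i \<in> D. g (v i) = w i"
proof -
  obtain N where N: "D \<subseteq> {..<N}" using \<open>finite D\<close> finite_nat_iff_bounded by blast
  define e where "e = from_nat_into (UNIV :: 'a set)"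
  have e: "surj e" unfolding e_def using count by (simp add: range_from_nat_into)
  \<comment> \<open>Pairs hold left and right values. Offset \<open>2 * k\<close> from
    \<open>N\<close> puts \<open>e k\<close> on the left, offset \<open>2 * k + 1\<close> on the
    right; variables below \<open>N\<close> outside \<open>D\<close> are unconstrained.\<close>
  define ok where "ok n u \<longleftrightarrow> elem_equiv L M (D \<union> {N..<n}) (fst \<circ> u) (snd \<circ> u) \<and>
      (\<forall>k. N + 2 * k < n \<longrightarrow> fst (u (N + 2 * k)) = e k) \<and>
      (\<forall>k. N + 2 * k + 1 < n \<longrightarrow> snd (u (N + 2 * k + 1)) = e k)"
    for n and u :: "nat \<Rightarrow> 'a \<times> 'a"
  have "\<exists>u. (\<forall>i<N. u i = (v i, w i)) \<and> (\<forall>n\<ge>N. ok n u)"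
  proof (rule ex_limit_sequence[of ok N "\<lambda>i. (v i, w i)"])
    show "ok N (\<lambda>i. (v i, w i))" using eq by (simp add: ok_def comp_def)
  next
    fix n u assume n: "N \<le> n" and u: "ok n u"
    define D' where "D' = D \<union> {N..<n}"
    have D': "finite D'" "n \<notin> D'" "insert n D' = D \<union> {N..<Suc n}"
      using n N \<open>finite D\<close> by (auto simp: D'_def)
    have eq': "elem_equiv L M D' (fst \<circ> u) (snd \<circ> u)" using u by (simp add: ok_def D'_def)
    define k where "k = (n - N) div 2"
    have "\<exists>a b. elem_equiv L M (insert n D') ((fst \<circ> u)(n := a)) ((snd \<circ> u)(n := b)) \<and>
        (even (n - N) \<longrightarrow> a = e k) \<and> (odd (n - N) \<longrightarrow> b = e k)"
    proof (cases "even (n - N)")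
      case True
      then show ?thesis using elem_equiv_extend[OF inf sat D'(1,2) eq', of "e k"] by auto
    next
      case False
      then show ?thesis
        using elem_equiv_extend[OF inf sat D'(1,2) elem_equiv_sym[OF eq'], of "e k"]
        by (auto dest: elem_equiv_sym)
    qed
    then obtain a b where ab:
      "elem_equiv L M (insert n D') ((fst \<circ> u)(n := a)) ((snd \<circ> u)(n := b))"
      "even (n - N) \<Longrightarrow> a = e k" "odd (n - N) \<Longrightarrow> b = e k" by blast
    have "(fst \<circ> u)(n := a) = fst \<circ> u(n := (a, b))" "(snd \<circ> u)(n := b) = snd \<circ> u(n := (a, b))"
      by auto
    with ab(1) D'(3) have 1:
      "elem_equiv L M (D \<union> {N..<Suc n}) (fst \<circ> u(n := (a, b))) (snd \<circ> u(n := (a, b)))"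
      by simp
    have 2: "fst ((u(n := (a, b))) (N + 2 * j)) = e j" if "N + 2 * j < Suc n" for j
    proof (cases "N + 2 * j = n")
      case True
      then have "k = j" "even (n - N)" by (auto simp: k_def)
      with True ab(2) show ?thesis by simp
    next
      case False
      with that u show ?thesis by (simp add: ok_def)
    qed
    have 3: "snd ((u(n := (a, b))) (N + 2 * j + 1)) = e j" if "N + 2 * j + 1 < Suc n" for j
    proof (cases "N + 2 * j + 1 = n")
      case True
      then have "k = j" "odd (n - N)" by (auto simp: k_def)
      with True ab(3) show ?thesis by simp
    next
      case False
      with that u show ?thesis by (simp add: ok_def)
    qed
    show "\<exists>c. ok (Suc n) (u(n := c))"
      using 1 2 3 unfolding ok_def by blast
  next
    fix n u u' assume n: "N \<le> n" and u: "ok n u" and agree: "\<forall>i<n. u i = (u' i :: 'a \<times> 'a)"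
    have "elem_equiv L M (D \<union> {N..<n}) (fst \<circ> u') (snd \<circ> u')"
      by (rule elem_equiv_cong[of L M _ "fst \<circ> u" "snd \<circ> u"]) (use n u agree N in \<open>auto simp: ok_def\<close>)
    with u agree show "ok n u'" by (auto simp: ok_def)
  qed
  then obtain u where u: "\<And>i. i < N \<Longrightarrow> u i = (v i, w i)" "\<And>n. n \<ge> N \<Longrightarrow> ok n u" by blast
  define E where "E = D \<union> {N..}"
  have "elem_equiv L M E (fst \<circ> u) (snd \<circ> u)"
    unfolding elem_equiv_def
  proof (intro allI impI)
    fix p assume p: "wf_form L p \<and> fv p \<subseteq> E"
    \<comment> \<open>A formula has finitely many free variables, so a finite stage decides it; the
      maximum is taken because \<open>ok\<close> is known only from \<open>N\<close> on.\<close>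
    obtain n where "\<forall>i \<in> fv p. i < n" using finite_fv finite_nat_set_iff_bounded by blast
    with p have "fv p \<subseteq> D \<union> {N..<max n N}" by (fastforce simp: E_def)
    with p u(2)[of "max n N"] show "sat M (fst \<circ> u) p = sat M (snd \<circ> u) p"
      by (simp add: ok_def elem_equiv_def)
  qed
  moreover have "a \<in> (fst \<circ> u) ` E" "a \<in> (snd \<circ> u) ` E" for a
  proof -
    obtain k where k: "a = e k" using e by blast
    \<comment> \<open>This stage is past both positions reserved for \<open>e k\<close>.\<close>
    have "ok (N + 2 * k + 2) u" using u(2) by simp
    then have "fst (u (N + 2 * k)) = a" "snd (u (N + 2 * k + 1)) = a"
      by (simp_all add: ok_def k)
    moreover have "N + 2 * k \<in> E" "N + 2 * k + 1 \<in> E" by (auto simp: E_def)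
    ultimately show "a \<in> (fst \<circ> u) ` E" "a \<in> (snd \<circ> u) ` E"
      unfolding image_comp[symmetric] by (metis image_eqI)+
  qed
  then have "(fst \<circ> u) ` E = UNIV" "(snd \<circ> u) ` E = UNIV" by blast+
  ultimately obtain g where g: "g \<in> Aut L M" "\<forall>i \<in> E. g ((fst \<circ> u) i) = (snd \<circ> u) i"
    using Aut_of_elem_equiv by blast
  have "g (v i) = w i" if "i \<in> D" for i
  proof -
    have "i \<in> E" "i < N" using that N by (auto simp: E_def)
    with g(2) u(1) show ?thesis by auto
  qed
  with g(1) show ?thesis by blast
qed


section \<open>The closure of the automorphism group\<close>

lemma eval_Aut:
  assumes "g \<in> Aut L M" "wf_trm L t"
  shows "eval M (g \<circ> v) t = g (eval M v t)"
  using assms(2)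
proof (induction t)
  case (Fn f ts)
  have "eval M (g \<circ> v) t = g (eval M v t)" if "t \<in> set ts" for t
    using that Fn.prems by (intro Fn.IH) auto
  then have "map (eval M (g \<circ> v)) ts = map g (map (eval M v) ts)" by simp
  moreover have "g (finterp M f (map (eval M v) ts)) = finterp M f (map g (map (eval M v) ts))"
    using assms(1) Fn.prems by (auto simp: Aut_def)
  ultimately show ?case by (simp only: eval.simps)
qed simp

lemma sat_Aut:
  assumes "g \<in> Aut L M" "wf_form L p"
  shows "sat M (g \<circ> v) p \<longleftrightarrow> sat M v p"
  using assms(2)
proof (induction p arbitrary: v)
  case (Eq s t)
  have "inj g" using assms(1) by (simp add: Aut_def bij_def)
  with Eq show ?case by (simp add: eval_Aut[OF assms(1)] inj_eq del: o_apply)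
next
  case (Rel r ts)
  then have "map (eval M (g \<circ> v)) ts = map g (map (eval M v) ts)"
    by (auto simp: eval_Aut[OF assms(1)])
  moreover have "rinterp M r (map g (map (eval M v) ts)) \<longleftrightarrow> rinterp M r (map (eval M v) ts)"
    using assms(1) Rel.prems by (simp add: Aut_def del: map_map)
  ultimately show ?case by (simp only: sat.simps)
next
  case (Ex n p)
  have "surj g" using assms(1) by (simp add: Aut_def bij_def)
  then have "(\<exists>b. sat M ((g \<circ> v)(n := b)) p) \<longleftrightarrow> (\<exists>a. sat M ((g \<circ> v)(n := g a)) p)"
    by (metis surj_def)
  moreover have "(g \<circ> v)(n := g a) = g \<circ> v(n := a)" for a by auto
  moreover have "sat M (g \<circ> v(n := a)) p \<longleftrightarrow> sat M (v(n := a)) p" for a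
    by (rule Ex.IH) (use Ex.prems in simp)
  ultimately show ?case by (simp only: sat.simps)
qed auto

section \<open>Pointwise convergence as agreement on finite sets\<close>

lemma openin_tau_pw_agree:
  assumes "finite A"
  shows "openin tau_pw {t. \<forall>a \<in> A. t a = s a}"
proof -
  have "{t. \<forall>a \<in> A. t a = s a} = (\<Pi>\<^sub>E i \<in> UNIV. if i \<in> A then {s i} else UNIV)"
    by (auto simp: PiE_iff split: if_splits)
  moreover have "openin tau_pw \<dots>"
    unfolding tau_pw_def using assms by (intro product_topology_basis) (auto intro: rev_finite_subset)
  ultimately show ?thesis by simp
qed

lemma openin_tau_pw_contains_agree:
  assumes "openin tau_pw U" "s \<in> U"
  shows "\<exists>A. finite A \<and> {t. \<forall>a \<in> A. t a = s a} \<subseteq> U"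
proof -
  obtain W where W: "s \<in> (\<Pi>\<^sub>E i \<in> UNIV. W i)" "finite {i. W i \<noteq> UNIV}" "(\<Pi>\<^sub>E i \<in> UNIV. W i) \<subseteq> U"
    using product_topology_open_contains_basis[OF assms(1)[unfolded tau_pw_def] assms(2)]
    by auto
  have "t \<in> U" if "\<forall>a \<in> {i. W i \<noteq> UNIV}. t a = s a" for t
  proof -
    have "t i \<in> W i" for i using W(1) that by (cases "W i = UNIV") (auto simp: PiE_iff)
    then show ?thesis using W(3) by (auto simp: PiE_iff)
  qed
  with W(2) show ?thesis by blast
qed

lemma topspace_tau_pw: "topspace tau_pw = UNIV"
  by (simp add: tau_pw_def)

lemma in_closure_tau_pw_iff:
  fixes s :: "'a \<Rightarrow> 'a"
  shows "s \<in> tau_pw closure_of G \<longleftrightarrow> (\<forall>A. finite A \<longrightarrow> (\<exists>g \<in> G. \<forall>a \<in> A. g a = s a))"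
proof
  assume s: "s \<in> tau_pw closure_of G"
  show "\<forall>A. finite A \<longrightarrow> (\<exists>g \<in> G. \<forall>a \<in> A. g a = s a)"
  proof (intro allI impI)
    fix A :: "'a set" assume "finite A"
    then have "openin tau_pw {t. \<forall>a \<in> A. t a = s a}" by (rule openin_tau_pw_agree)
    then show "\<exists>g \<in> G. \<forall>a \<in> A. g a = s a"
      using s[unfolded in_closure_of, THEN conjunct2, rule_format, of "{t. \<forall>a \<in> A. t a = s a}"]
      by auto
  qed
next
  assume *: "\<forall>A. finite A \<longrightarrow> (\<exists>g \<in> G. \<forall>a \<in> A. g a = s a)"
  show "s \<in> tau_pw closure_of G"
    unfolding in_closure_of
  proof (intro conjI allI impI)
    fix T assume "s \<in> T \<and> openin tau_pw T"
    then obtain A where "finite A" "{t. \<forall>a \<in> A. t a = s a} \<subseteq> T"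
      using openin_tau_pw_contains_agree by blast
    with * show "\<exists>y. y \<in> G \<and> y \<in> T" by blast
  qed (simp add: topspace_tau_pw)
qed

text \<open>A formula sees only finitely many values of \<open>v\<close>, and there \<open>s\<close>
  agrees with an automorphism. Thus elements of the closure are elementary embeddings.\<close>

lemma sat_closure_Aut:
  assumes "s \<in> tau_pw closure_of Aut L M" "wf_form L p"
  shows "sat M (s \<circ> v) p \<longleftrightarrow> sat M v p"
proof -
  obtain g where g: "g \<in> Aut L M" "\<forall>a \<in> v ` fv p. g a = s a"
    using assms(1) finite_fv unfolding in_closure_tau_pw_iff by blast
  have "sat M (s \<circ> v) p = sat M (g \<circ> v) p"
    by (rule sat_cong) (use g(2) in auto)
  with sat_Aut[OF g(1) assms(2)] show ?thesis by simp
qed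

text \<open>Conversely, homogeneity yields, for any finite set, an automorphism agreeing there with
  a given elementary embedding. The embedding is coded by two tuples, the first exhausting the
  universe.\<close>

lemma elem_equiv_in_closure_Aut:
  fixes M :: "('f, 'r, 'a) struct"
  assumes "countable (UNIV :: 'a set)" "infinite (UNIV :: 'a set)" "saturated L M"
    and eq: "elem_equiv L M D v w" and "v ` D = UNIV" and s: "\<And>i. i \<in> D \<Longrightarrow> s (v i) = w i"
  shows "s \<in> tau_pw closure_of Aut L M"
  unfolding in_closure_tau_pw_iff
proof (intro allI impI)
  fix A :: "'a set" assume "finite A"
  then obtain C where C: "C \<subseteq> D" "finite C" "A = v ` C"
    using finite_subset_image[of A v D] assms(5) by blast
  have "elem_equiv L M C v w" using eq C(1) by (auto simp: elem_equiv_def)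
  then obtain g where "g \<in> Aut L M" "\<forall>i \<in> C. g (v i) = w i"
    using saturated_homogeneous[OF assms(1-3) C(2)] by blast
  then show "\<exists>g \<in> Aut L M. \<forall>a \<in> A. g a = s a" using C s by (intro bexI[of _ g]) auto
qed

text \<open>Variables \<open>2i\<close> and \<open>2i + 1\<close> stand for the values of two elementary embeddings at the
  \<open>i\<close>-th element of the universe.\<close>

lemma closure_Aut_locally_determined:
  fixes M :: "('f, 'r, 'a) struct"
  assumes count: "countable (UNIV :: 'a set)" and inf: "infinite (UNIV :: 'a set)"
    and sat: "saturated L M"
    and sep: "\<And>t t'. t \<in> tau_pw closure_of Aut L M \<Longrightarrow> t' \<in> tau_pw closure_of Aut L M \<Longrightarrow>
       \<forall>x \<in> X. t x = t' x \<Longrightarrow> t = t'"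
    and s: "s \<in> tau_pw closure_of Aut L M"
  shows "\<exists>A. finite A \<and> A \<subseteq> X \<and>
    (\<forall>t \<in> tau_pw closure_of Aut L M. (\<forall>a \<in> A. t a = s a) \<longrightarrow> t b = s b)"
proof (rule ccontr)
  assume "\<not> ?thesis"
  then have neg: "\<exists>t \<in> tau_pw closure_of Aut L M. (\<forall>a \<in> A. t a = s a) \<and> t b \<noteq> s b"
    if "finite A" "A \<subseteq> X" for A
    using that by blast
  define e where "e = from_nat_into (UNIV :: 'a set)"
  have "bij e" unfolding e_def using bij_betw_from_nat_into[OF count inf] .
  \<comment> \<open>Both \<open>2 * i\<close> and \<open>2 * i + 1\<close> get the value
    \<open>e i\<close>, so the universe is enumerated once along the even and once along the odd
    variables.\<close>
  define m where "m j = e (j div 2)" for j :: nat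
  define \<Sigma> where "\<Sigma> = {p. wf_form L p \<and> (fv p \<subseteq> Collect even \<or> fv p \<subseteq> Collect odd) \<and> sat M m p}
    \<union> {Eq (Var (2 * i)) (Var (2 * i + 1)) | i. e i \<in> X}
    \<union> {Neg (Eq (Var (2 * i)) (Var (2 * i + 1))) | i. e i = b}"
  have "\<exists>v. \<forall>p \<in> \<Sigma>. sat M v p"
  proof (rule saturated_realizes_all[OF inf sat])
    fix p assume "p \<in> \<Sigma>"
    then show "wf_form L p" by (auto simp: \<Sigma>_def)
  next
    fix F assume F: "finite F" "F \<subseteq> \<Sigma>"
    \<comment> \<open>\<open>F\<close> mentions only finitely many elements of \<open>X\<close>, so
      a \<open>t\<close> agreeing with \<open>s\<close> on those is enough.\<close>
    define A where "A = X \<inter> m ` (\<Union>p \<in> F. fv p)"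
    have "finite A" "A \<subseteq> X" using F(1) finite_fv by (auto simp: A_def)
    then obtain t where t: "t \<in> tau_pw closure_of Aut L M" "\<forall>a \<in> A. t a = s a" "t b \<noteq> s b"
      using neg by blast
    define w where "w j = (if even j then s (m j) else t (m j))" for j
    have "sat M w p" if "p \<in> F" for p
    proof -
      have "p \<in> \<Sigma>" using F(2) that by blast
      then consider "wf_form L p" "fv p \<subseteq> Collect even" "sat M m p"
        | "wf_form L p" "fv p \<subseteq> Collect odd" "sat M m p"
        | i where "p = Eq (Var (2 * i)) (Var (2 * i + 1))" "e i \<in> X"
        | i where "p = Neg (Eq (Var (2 * i)) (Var (2 * i + 1)))" "e i = b"
        unfolding \<Sigma>_def by blast
      then show ?thesis
      proof cases
        case 1
        have "sat M w p = sat M (s \<circ> m) p"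
          by (rule sat_cong) (use 1(2) in \<open>auto simp: w_def\<close>)
        with sat_closure_Aut[OF s] 1 show ?thesis by simp
      next
        case 2
        have "sat M w p = sat M (t \<circ> m) p"
          by (rule sat_cong) (use 2(2) in \<open>auto simp: w_def\<close>)
        with sat_closure_Aut[OF t(1)] 2 show ?thesis by simp
      next
        case 3
        have "2 * i \<in> fv p" "m (2 * i) = e i" by (simp_all add: 3(1) m_def)
        with 3(2) that have "e i \<in> A" unfolding A_def by (metis IntI UN_I imageI)
        with t(2) show ?thesis by (simp add: 3(1) w_def m_def)
      next
        case 4
        with t(3) show ?thesis by (simp add: w_def m_def)
      qed
    qed
    then show "\<exists>v. \<forall>p \<in> F. sat M v p" by blast
  qed
  then obtain v where v: "\<And>p. p \<in> \<Sigma> \<Longrightarrow> sat M v p" by blast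
  have equiv: "elem_equiv L M D m v" if D: "D = Collect even \<or> D = Collect odd" for D
    unfolding elem_equiv_def
  proof (intro allI impI)
    fix p assume p: "wf_form L p \<and> fv p \<subseteq> D"
    show "sat M m p = sat M v p"
    proof (cases "sat M m p")
      case True
      with p D have "p \<in> \<Sigma>" by (auto simp: \<Sigma>_def)
      with v True show ?thesis by simp
    next
      case False
      with p D have "Neg p \<in> \<Sigma>" by (auto simp: \<Sigma>_def)
      from v[OF this] False show ?thesis by simp
    qed
  qed
  obtain d where d: "\<And>a. e (d a) = a" using \<open>bij e\<close> by (metis bij_pointE)
  have d': "d (e i) = i" for i using d \<open>bij e\<close> by (metis bij_def injD)
  \<comment> \<open>The even and odd halves of \<open>v\<close> are reindexed by elements through
    the inverse \<open>d\<close> of \<open>e\<close>.\<close>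
  define t0 where "t0 a = v (2 * d a)" for a
  define t1 where "t1 a = v (2 * d a + 1)" for a
  have "a \<in> m ` Collect even" for a
    by (rule image_eqI[of _ _ "2 * d a"]) (auto simp: m_def d)
  then have "t0 \<in> tau_pw closure_of Aut L M"
    by (intro elem_equiv_in_closure_Aut[OF count inf sat equiv, of "Collect even"])
      (auto simp: t0_def m_def d')
  moreover have "a \<in> m ` Collect odd" for a
    by (rule image_eqI[of _ _ "2 * d a + 1"]) (auto simp: m_def d)
  then have "t1 \<in> tau_pw closure_of Aut L M"
    by (intro elem_equiv_in_closure_Aut[OF count inf sat equiv, of "Collect odd"])
      (auto simp: t1_def m_def d')
  moreover have "t0 x = t1 x" if "x \<in> X" for x
  proof -
    have "Eq (Var (2 * d x)) (Var (2 * d x + 1)) \<in> \<Sigma>" using that d by (auto simp: \<Sigma>_def)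
    from v[OF this] show ?thesis by (simp add: t0_def t1_def)
  qed
  ultimately have "t0 = t1" using sep by blast
  moreover have "Neg (Eq (Var (2 * d b)) (Var (2 * d b + 1))) \<in> \<Sigma>" using d by (auto simp: \<Sigma>_def)
  from v[OF this] have "t0 b \<noteq> t1 b" by (simp add: t0_def t1_def)
  ultimately show False by simp
qed


section \<open>The localised topology\<close>

lemma extending_restrict:
  "extending S ((Some \<circ> g) |` A) = {s \<in> S. \<forall>a \<in> A. s a = g a}"
proof -
  have "dom ((Some \<circ> g) |` A) = A" by (auto simp: restrict_map_def split: if_splits)
  then show ?thesis by (auto simp: extending_def restrict_map_def fun_eq_iff)
qed

text \<open>Sets that do not separate \<open>s\<close> from \<open>t\<close> are closed under
  intersections and unions.\<close>

lemma generate_topology_on_indistinguishable: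
  assumes "generate_topology_on \<B> U" "\<And>B. B \<in> \<B> \<Longrightarrow> s \<in> B \<longleftrightarrow> t \<in> B"
  shows "s \<in> U \<longleftrightarrow> t \<in> U"
  using assms(1)
proof (induction rule: generate_topology_on.induct)
  case (UN K)
  then show ?case by blast
qed (use assms(2) in auto)

theorem theorem3p16:
  fixes L :: "('f, 'r) lang"
    and M :: "('f, 'r, 'a) struct"
    and G Gbar :: "('a \<Rightarrow> 'a) set"
    and X :: "'a set"
  assumes "countable (UNIV :: 'a set)"
    and "infinite (UNIV :: 'a set)"
    and "saturated L M"
    and "G = Aut L M"
    and "Gbar = tau_pw closure_of G"
    and "invariant_under G X"
  shows "tau_pw_local G X Gbar = subtopology tau_pw Gbar
         \<or> \<not> t1_space (tau_pw_local G X Gbar)"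
proof (rule disjCI)
  assume "\<not> \<not> t1_space (tau_pw_local G X Gbar)"
  then have t1: "t1_space (tau_pw_local G X Gbar)" by simp
  define \<B> where "\<B> = {extending Gbar \<phi> | \<phi>. \<exists>g \<in> G. \<exists>A. finite A \<and> A \<subseteq> X \<and> g ` A \<subseteq> X \<and>
      \<phi> = (Some \<circ> g) |` A}"
  have local: "tau_pw_local G X Gbar = topology_generated_by \<B>"
    by (simp add: tau_pw_local_def \<B>_def)
  have basic: "\<exists>g A. finite A \<and> A \<subseteq> X \<and> B = {s \<in> Gbar. \<forall>a \<in> A. s a = g a}" if "B \<in> \<B>" for B
  proof -
    obtain g A where "finite A" "A \<subseteq> X" "B = extending Gbar ((Some \<circ> g) |` A)"
      using \<open>B \<in> \<B>\<close> unfolding \<B>_def by blast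
    then show ?thesis unfolding extending_restrict by blast
  qed
  have "id \<in> G" by (simp add: assms(4) Aut_def)
  then have topsp: "topspace (tau_pw_local G X Gbar) = Gbar"
    by (intro topspace_tau_pw_local) auto
  \<comment> \<open>Subbasic sets test values on \<open>X\<close> only, so elements of
    \<open>Gbar\<close> agreeing on \<open>X\<close> lie in the same open sets, and T1 makes them
    equal.\<close>
  have sep: "t = t'" if "t \<in> Gbar" "t' \<in> Gbar" "\<forall>x \<in> X. t x = t' x" for t t'
  proof (rule ccontr)
    assume "t \<noteq> t'"
    with t1 that topsp obtain U where U: "openin (tau_pw_local G X Gbar) U" "t \<in> U" "t' \<notin> U"
      unfolding t1_space_def by metis
    have "t \<in> B \<longleftrightarrow> t' \<in> B" if "B \<in> \<B>" for B
      using basic[OF that] \<open>t \<in> Gbar\<close> \<open>t' \<in> Gbar\<close> \<open>\<forall>x \<in> X. t x = t' x\<close> by (auto simp: subset_iff)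
    from generate_topology_on_indistinguishable[OF _ this] U show False
      by (auto simp: local openin_topology_generated_by_iff)
  qed
  show "tau_pw_local G X Gbar = subtopology tau_pw Gbar"
    unfolding topology_eq
  proof (intro allI iffI)
    fix U assume "openin (tau_pw_local G X Gbar) U"
    then have "generate_topology_on \<B> U" by (simp add: local openin_topology_generated_by_iff)
    moreover have "openin (subtopology tau_pw Gbar) B" if "B \<in> \<B>" for B
    proof -
      obtain g A where "finite A" "B = {s \<in> Gbar. \<forall>a \<in> A. s a = g a}"
        using basic[OF \<open>B \<in> \<B>\<close>] by blast
      then show ?thesis unfolding openin_subtopology
        by (intro exI[of _ "{t. \<forall>a \<in> A. t a = g a}"]) (auto simp: openin_tau_pw_agree)
    qed
    ultimately show "openin (subtopology tau_pw Gbar) U"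
      using generate_topology_on_coarsest[OF istopology_openin] by blast
  next
    fix U assume "openin (subtopology tau_pw Gbar) U"
    then obtain W where W: "openin tau_pw W" "U = W \<inter> Gbar" by (auto simp: openin_subtopology)
    show "openin (tau_pw_local G X Gbar) U"
    proof (subst openin_subopen, intro ballI)
      fix s assume "s \<in> U"
      with W obtain C where C: "finite C" "{t. \<forall>c \<in> C. t c = s c} \<subseteq> W"
        using openin_tau_pw_contains_agree by blast
      have s: "s \<in> Gbar" using \<open>s \<in> U\<close> W by blast
      \<comment> \<open>Saturation enters here: even for \<open>c\<close> outside \<open>X\<close>,
        the value \<open>s c\<close> is determined by finitely many values on
        \<open>X\<close>.\<close>
      have "\<forall>c. \<exists>A. finite A \<and> A \<subseteq> X \<and> (\<forall>t \<in> Gbar. (\<forall>a \<in> A. t a = s a) \<longrightarrow> t c = s c)"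
        using closure_Aut_locally_determined[OF assms(1-3), of X s] sep s
        unfolding assms(4,5) by blast
      then obtain A where A: "\<And>c. finite (A c)" "\<And>c. A c \<subseteq> X"
        "\<And>c t. t \<in> Gbar \<Longrightarrow> \<forall>a \<in> A c. t a = s a \<Longrightarrow> t c = s c" by metis
      define A' where "A' = \<Union>(A ` C)"
      have A': "finite A'" "A' \<subseteq> X" using A C(1) by (auto simp: A'_def)
      \<comment> \<open>Subbasic sets come from restrictions of elements of \<open>G\<close>, so an
        automorphism has to stand in for \<open>s\<close> on \<open>A'\<close>; invariance then
        keeps the image of \<open>A'\<close> inside \<open>X\<close>.\<close>
      obtain g where g: "g \<in> G" "\<forall>a \<in> A'. g a = s a"
        using s A'(1) unfolding assms(5) in_closure_tau_pw_iff by blast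
      have "g ` A' \<subseteq> X" using assms(6) g(1) A'(2) by (auto simp: invariant_under_def)
      with g(1) A' have "extending Gbar ((Some \<circ> g) |` A') \<in> \<B>" unfolding \<B>_def by blast
      then have "openin (tau_pw_local G X Gbar) (extending Gbar ((Some \<circ> g) |` A'))"
        unfolding local by (rule topology_generated_by_Basis)
      moreover have "s \<in> extending Gbar ((Some \<circ> g) |` A')"
        using s g(2) by (simp add: extending_restrict)
      moreover have "extending Gbar ((Some \<circ> g) |` A') \<subseteq> U"
      proof
        fix t assume "t \<in> extending Gbar ((Some \<circ> g) |` A')"
        then have t: "t \<in> Gbar" "\<forall>a \<in> A'. t a = s a" using g(2) by (auto simp: extending_restrict)
        then have "t c = s c" if "c \<in> C" for c
          using A(3)[of t c] that by (auto simp: A'_def)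
        with C(2) t(1) W(2) show "t \<in> U" by blast
      qed
      ultimately show "\<exists>T. openin (tau_pw_local G X Gbar) T \<and> s \<in> T \<and> T \<subseteq> U" by blast
    qed
  qed
qed

end
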